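(* Let $(M_t)_{t\ge 0}$ be a nonnegative discrete-time supermartingale with respect to a filtration $(\mathcal{F}_t)_{t\ge 0}$, with $M_0=1$. Let $S_t=\max_{s\le t}M_s$, $\tau_F=\max\{s\ge 0:M_s=S_s\}$, $Z_t=\Pr(\tau_F\ge t\mid\mathcal{F}_t)$, and $R_t=\min_{s\le t}\frac{M_s}{S_s}$. Let $\mathcal{U}$ be a $\mathrm{Uniform}([0,1])$ random variable. Then: (a) For any stopping time $\tau\le\tau_F$, $R_\tau\succeq\mathcal{U}$. (b) Define $\rho_F:=\max\{t\le\tau_F: Z_t=\min_{u\le\tau_F}Z_u\}$. Then $R_t\ge\Pr(\rho_F>t\mid\mathcal{F}_t)$ for every $t$.
   Context: For real random variables, $X\succeq Y$ (first-order stochastic dominance) means $\Pr(X\ge c)\ge\Pr(Y\ge c)$ for all $c\in\mathbb{R}$. Stopping times are with respect to $(\mathcal{F}_t)$. $\tau_F$ (which is not a stopping time in general) is the time of the final attained maximum of $M$, equal to $\infty$ if $M_s=S_s$ for infinitely many $s$. *)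

theory Defs
  imports "HOL-Probability.Probability" "HOL-Library.Extended_Nat"
begin

definition supermartingale ::
  "'a measure \<Rightarrow> (nat \<Rightarrow> 'a measure) \<Rightarrow> (nat \<Rightarrow> 'a \<Rightarrow> real) \<Rightarrow> bool" where
  "supermartingale P F M \<longleftrightarrow>
     (\<forall>t. M t \<in> borel_measurable (F t)) \<and>
     (\<forall>t. integrable P (M t)) \<and>
     (\<forall>t. AE \<omega> in P. real_cond_exp P (F t) (M (Suc t)) \<omega> \<le> M t \<omega>)"

(* The library's stopping_time gives the time the same type as the index of the filtration.
   Here the filtration is indexed by nat and the time may be infinite. *)
definition enat_stopping_time :: "(nat \<Rightarrow> 'a measure) \<Rightarrow> ('a \<Rightarrow> enat) \<Rightarrow> bool" where
  "enat_stopping_time F \<tau> \<longleftrightarrow> (\<forall>t. Measurable.pred (F t) (\<lambda>\<omega>. \<tau> \<omega> \<le> enat t))"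

definition stoch_dominates ::
  "'a measure \<Rightarrow> ('a \<Rightarrow> real) \<Rightarrow> 'b measure \<Rightarrow> ('b \<Rightarrow> real) \<Rightarrow> bool" where
  "stoch_dominates P X Q Y \<longleftrightarrow>
     (\<forall>c. measure P {\<omega> \<in> space P. X \<omega> \<ge> c} \<ge> measure Q {\<omega> \<in> space Q. Y \<omega> \<ge> c})"

definition prob_given :: "'a measure \<Rightarrow> 'a measure \<Rightarrow> ('a \<Rightarrow> bool) \<Rightarrow> 'a \<Rightarrow> real" where
  "prob_given P G E = real_cond_exp P G (indicator {\<omega> \<in> space P. E \<omega>})"

(* The maximum of a set of times: infinity if the set is infinite (and, by convention, 0 if it
   is empty). *)
definition last_time :: "nat set \<Rightarrow> enat" where
  "last_time A = (SUP t\<in>A. enat t)"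

definition running_max :: "(nat \<Rightarrow> 'a \<Rightarrow> real) \<Rightarrow> nat \<Rightarrow> 'a \<Rightarrow> real" where
  "running_max M t \<omega> = Max ((\<lambda>s. M s \<omega>) ` {..t})"

definition tau_F :: "(nat \<Rightarrow> 'a \<Rightarrow> real) \<Rightarrow> 'a \<Rightarrow> enat" where
  "tau_F M \<omega> = last_time {s. M s \<omega> = running_max M s \<omega>}"

definition Z :: "'a measure \<Rightarrow> (nat \<Rightarrow> 'a measure) \<Rightarrow> (nat \<Rightarrow> 'a \<Rightarrow> real) \<Rightarrow> nat \<Rightarrow> 'a \<Rightarrow> real" where
  "Z P F M t = prob_given P (F t) (\<lambda>\<omega>. tau_F M \<omega> \<ge> enat t)"

definition R :: "(nat \<Rightarrow> 'a \<Rightarrow> real) \<Rightarrow> nat \<Rightarrow> 'a \<Rightarrow> real" where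
  "R M t \<omega> = Min ((\<lambda>s. M s \<omega> / running_max M s \<omega>) ` {..t})"

(* R evaluated at a random time. A stopping time bounded by tau_F can be infinite where tau_F is;
   there R takes its limit value, the infimum, since R is nonincreasing in t. *)
definition R_at :: "(nat \<Rightarrow> 'a \<Rightarrow> real) \<Rightarrow> ('a \<Rightarrow> enat) \<Rightarrow> 'a \<Rightarrow> real" where
  "R_at M \<tau> \<omega> = (case \<tau> \<omega> of enat t \<Rightarrow> R M t \<omega> | \<infinity> \<Rightarrow> (INF t. R M t \<omega>))"

(* is_arg_min says that t is at most tau_F and Z_t is the attained minimum of Z over all u at
   most tau_F. If tau_F is infinite, u still ranges over the finite times only. *)
definition rho_F ::
  "'a measure \<Rightarrow> (nat \<Rightarrow> 'a measure) \<Rightarrow> (nat \<Rightarrow> 'a \<Rightarrow> real) \<Rightarrow> 'a \<Rightarrow> enat" where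
  "rho_F P F M \<omega> = last_time {t. is_arg_min (\<lambda>u. Z P F M u \<omega>) (\<lambda>u. enat u \<le> tau_F M \<omega>) t}"

end

theory Submission
  imports Defs
begin

text \<open>
  Ville's maximal inequality, applied conditionally on \<open>F t\<close> at the level \<open>S t\<close>, gives
  \<open>Z t \<le> M t / S t\<close>. Moreover, whenever a stopping time \<open>\<sigma>\<close> satisfies \<open>Z \<sigma> \<le> g\<close> on
  \<open>\<sigma> < \<infinity>\<close>, conditioning at \<open>\<sigma>\<close> bounds the probability of \<open>\<sigma> < \<infinity>, \<sigma> \<le> \<tau>\<^sub>F\<close> by the
  integral of \<open>g\<close>. For (a), \<open>\<sigma>\<close> is the first time at which \<open>M / S\<close> drops below \<open>c\<close>. For (b),
  \<open>\<sigma>\<close> is the first time after \<open>t\<close> at which \<open>Z\<close> is at most \<open>R t\<close>; it is finite and at most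
  \<open>\<tau>\<^sub>F\<close> whenever \<open>\<rho>\<^sub>F > t\<close>, because \<open>min\<^bsub>u \<le> t\<^esub> Z u \<le> R t\<close>.
\<close>

section \<open>Last times, running maxima and ratios along a single path\<close>

lemma enat_less_last_time_iff: "enat k < last_time A \<longleftrightarrow> (\<exists>s\<in>A. k < s)"
  by (simp add: last_time_def less_SUP_iff)

lemma running_max_0: "running_max M 0 \<omega> = M 0 \<omega>"
  by (simp add: running_max_def)

lemma running_max_ge: "s \<le> t \<Longrightarrow> M s \<omega> \<le> running_max M t \<omega>"
  by (simp add: running_max_def)

lemma running_max_mono: "s \<le> t \<Longrightarrow> running_max M s \<omega> \<le> running_max M t \<omega>"
  unfolding running_max_def by (rule Max_mono) auto

text \<open>At \<open>t = 0\<close> both sides hold, since time 0 attains its running maximum; hence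
  the value of \<open>last_time\<close> at the empty set never matters here. For
  \<open>t = Suc k\<close> the bound is the strict one at \<open>k\<close>, and a strict bound below
  a supremum has a witness even when the supremum is \<infinity>.\<close>

lemma le_tau_F_iff: "enat t \<le> tau_F M \<omega> \<longleftrightarrow> (\<exists>s\<ge>t. M s \<omega> = running_max M s \<omega>)"
proof (cases t)
  case 0
  then show ?thesis
    by (metis i0_lb running_max_0 zero_enat_def zero_le)
next
  case (Suc k)
  have "enat t \<le> tau_F M \<omega> \<longleftrightarrow> enat k < tau_F M \<omega>"
    unfolding Suc by (metis Suc_ile_eq)
  then show ?thesis
    by (auto simp: tau_F_def enat_less_last_time_iff Suc Suc_le_eq)
qed

lemma R_le_ratio: "s \<le> t \<Longrightarrow> R M t \<omega> \<le> M s \<omega> / running_max M s \<omega>"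
  by (simp add: R_def)

lemma R_less_iff: "R M t \<omega> < c \<longleftrightarrow> (\<exists>s\<le>t. M s \<omega> / running_max M s \<omega> < c)"
  by (auto simp: R_def Min_less_iff)

lemma le_R_iff: "c \<le> R M t \<omega> \<longleftrightarrow> (\<forall>s\<le>t. c \<le> M s \<omega> / running_max M s \<omega>)"
  by (auto simp: R_def)

section \<open>The upper tail of the uniform distribution\<close>

text \<open>The distribution function yields the strict tails \<open>U \<omega> > d\<close>. The
  closed tail at \<open>c\<close> lies inside each of them with \<open>d < c\<close>, and letting
  \<open>d\<close> increase to \<open>c\<close> gives the bound.\<close>

lemma (in prob_space) uniform_ge_le:
  assumes U: "distributed M lborel U (\<lambda>x. indicator {0..1} x / measure lborel {0..1::real})"
    and "c \<le> 1"
  shows "prob {\<omega> \<in> space M. c \<le> U \<omega>} \<le> 1 - c"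
proof (cases "0 < c")
  case False
  then show ?thesis
    using prob_le_1[of "{\<omega> \<in> space M. c \<le> U \<omega>}"] by linarith
next
  case True
  have [measurable]: "U \<in> borel_measurable M"
    using distributed_measurable[OF U] by simp
  have "prob {\<omega> \<in> space M. c \<le> U \<omega>} \<le> 1 - d" if "0 < d" "d < c" for d
  proof -
    have "prob {\<omega> \<in> space M. c \<le> U \<omega>} \<le> prob {\<omega> \<in> space M. \<not> U \<omega> \<le> d}"
      using that by (intro finite_measure_mono) auto
    also have "\<dots> = 1 - prob {\<omega> \<in> space M. U \<omega> \<le> d}"
      by (rule prob_neg) measurable
    also have "\<dots> = 1 - d"
      using uniform_distributed_measure[OF U, of d] that \<open>c \<le> 1\<close> by simp
    finally show ?thesis .
  qed
  then show ?thesis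
    using True dense_le_bounded[of 0 c "1 - prob {\<omega> \<in> space M. c \<le> U \<omega>}"]
    by (simp add: algebra_simps)
qed

section \<open>Conditional probabilities and hitting events in a general probability space\<close>

lemma (in prob_space) integrable_indicator_event:
  "A \<in> events \<Longrightarrow> integrable M (indicator A :: 'a \<Rightarrow> real)"
  by (rule integrable_real_indicator) (simp_all add: emeasure_eq_measure)

lemma (in prob_space) integrable_indicator_mult:
  assumes "A \<in> events" "B \<in> events"
  shows "integrable M (\<lambda>\<omega>. indicator A \<omega> * indicator B \<omega> :: real)"
proof -
  have "integrable M (indicator (A \<inter> B) :: 'a \<Rightarrow> real)"
    using assms by (intro integrable_indicator_event) auto
  then show ?thesis
    by (metis (no_types, lifting) ext indicator_inter_arith)
qed

lemma (in prob_space) integral_indicator_mult: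
  assumes "A \<in> events" "B \<in> events"
  shows "(\<integral>\<omega>. indicator A \<omega> * indicator B \<omega> \<partial>M) = prob (A \<inter> B)"
proof -
  have "(\<integral>\<omega>. indicator A \<omega> * indicator B \<omega> \<partial>M) = (\<integral>\<omega>. indicator (A \<inter> B) \<omega> \<partial>M :: real)"
    by (rule Bochner_Integration.integral_cong) (simp_all add: indicator_inter_arith)
  also have "\<dots> = prob (A \<inter> B)"
    using assms sets.sets_into_space[of A M] by (simp add: Int_absorb2 Int_assoc le_infI1)
  finally show ?thesis .
qed

text \<open>The set where the conditional probability exceeds \<open>g\<close> belongs to
  \<open>G\<close>, so it is an admissible test set. On it the difference is positive while its
  integral is at most 0, so the set is null.\<close>

lemma (in prob_space) cond_prob_le:
  assumes sub: "subalgebra M G" and B[measurable]: "B \<in> events"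
    and g: "g \<in> borel_measurable G" "integrable M g"
    and le: "\<And>A. A \<in> sets G \<Longrightarrow> prob (A \<inter> B) \<le> (\<integral>\<omega>. indicator A \<omega> * g \<omega> \<partial>M)"
  shows "AE \<omega> in M. real_cond_exp M G (indicator B) \<omega> \<le> g \<omega>"
proof -
  interpret finite_measure_subalgebra M G
    by unfold_locales (rule sub)
  define h where "h = real_cond_exp M G (indicator B)"
  have h[measurable]: "h \<in> borel_measurable G"
    by (simp add: h_def)
  have int_h: "integrable M h"
    unfolding h_def by (rule real_cond_exp_int(1)[OF integrable_indicator_event[OF B]])
  note g(1)[measurable]
  define A where "A = {\<omega> \<in> space G. g \<omega> < h \<omega>}"
  have A: "A \<in> sets G"
    unfolding A_def by measurable
  then have A'[measurable]: "A \<in> events"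
    using sub by (auto simp: subalgebra_def)
  have int: "integrable M (\<lambda>\<omega>. indicator A \<omega> * h \<omega>)" "integrable M (\<lambda>\<omega>. indicator A \<omega> * g \<omega>)"
    using integrable_mult_indicator[OF A' int_h] integrable_mult_indicator[OF A' g(2)] by simp_all
  have "(\<integral>\<omega>. indicator A \<omega> * h \<omega> \<partial>M) = (\<integral>\<omega>. indicator A \<omega> * indicator B \<omega> \<partial>M)"
    unfolding h_def
    by (rule real_cond_exp_intg(2)[OF integrable_indicator_mult[OF A' B]
          borel_measurable_indicator[OF A] borel_measurable_indicator[OF B]])
  also have "\<dots> = prob (A \<inter> B)"
    by (rule integral_indicator_mult[OF A' B])
  finally have le0: "(\<integral>\<omega>. indicator A \<omega> * h \<omega> - indicator A \<omega> * g \<omega> \<partial>M) \<le> 0"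
    using le[OF A] int by simp
  have nonneg: "0 \<le> indicator A \<omega> * h \<omega> - indicator A \<omega> * g \<omega>" for \<omega>
    by (auto simp: A_def indicator_def)
  have "(\<integral>\<omega>. indicator A \<omega> * h \<omega> - indicator A \<omega> * g \<omega> \<partial>M) = 0"
    by (rule antisym[OF le0 Bochner_Integration.integral_nonneg[OF nonneg]])
  then have "AE \<omega> in M. indicator A \<omega> * h \<omega> - indicator A \<omega> * g \<omega> = 0"
    using integral_nonneg_eq_0_iff_AE[OF Bochner_Integration.integrable_diff[OF int] AE_I2[OF nonneg]]
    by blast
  then have "AE \<omega> in M. h \<omega> \<le> g \<omega>"
  proof (rule AE_mp, intro AE_I2 impI)
    fix \<omega> assume "\<omega> \<in> space M" "indicator A \<omega> * h \<omega> - indicator A \<omega> * g \<omega> = 0"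
    then show "h \<omega> \<le> g \<omega>"
      using sub by (cases "\<omega> \<in> A") (auto simp: A_def subalgebra_def)
  qed
  then show ?thesis by (simp add: h_def)
qed

text \<open>
  Since \<open>E\<close> is decreasing, only the first \<open>s\<close> with \<open>\<omega> \<in> p s\<close> matters.
\<close>

lemma (in prob_space) prob_hitting_le:
  fixes F :: "nat \<Rightarrow> 'a measure"
  assumes filt: "filtration (space M) F" and sub: "\<And>t. subalgebra M (F t)"
    and p: "\<And>s. p s \<in> sets (F s)"
    and E: "\<And>s. E s \<in> events" "\<And>r s. r \<le> s \<Longrightarrow> E s \<subseteq> E r"
    and g: "integrable M g" "AE \<omega> in M. 0 \<le> g \<omega>"
    and le: "\<And>s. AE \<omega> in M. \<omega> \<in> p s \<longrightarrow> real_cond_exp M (F s) (indicator (E s)) \<omega> \<le> g \<omega>"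
  shows "prob (\<Union>s. p s \<inter> E s) \<le> (\<integral>\<omega>. g \<omega> \<partial>M)"
proof -
  \<comment> \<open>\<open>C s\<close> is the event that \<open>s\<close> is the first time with
    \<open>\<omega> \<in> p s\<close>. It lies in \<open>F s\<close>, so conditioning on
    \<open>F s\<close> is possible on it, and these events are disjoint.\<close>
  define C where "C = disjointed p"
  have p': "p r \<in> sets (F s)" if "r \<le> s" for r s
    using p[of r] filtration.sets_F_mono[OF filt that] by auto
  have C: "C s \<in> sets (F s)" for s
    unfolding C_def disjointed_def by (intro sets.Diff sets.finite_UN) (auto intro: p')
  then have C'[measurable]: "C s \<in> events" for s
    using sub by (auto simp: subalgebra_def)
  have disj: "disjoint_family C"
    unfolding C_def by (rule disjoint_family_disjointed)
  note E(1)[measurable]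
  have sub_CE: "(\<Union>s. p s \<inter> E s) \<subseteq> (\<Union>s. C s \<inter> E s)"
  proof
    fix \<omega> assume "\<omega> \<in> (\<Union>s. p s \<inter> E s)"
    then obtain s where s: "\<omega> \<in> p s" "\<omega> \<in> E s" by auto
    define r where "r = (LEAST r. \<omega> \<in> p r)"
    have "\<omega> \<in> p r" "r \<le> s" "\<And>q. q < r \<Longrightarrow> \<omega> \<notin> p q"
      unfolding r_def using s(1) by (auto intro: LeastI Least_le dest: not_less_Least)
    then have "\<omega> \<in> C r" "\<omega> \<in> E r"
      using E(2)[of r s] s(2) by (auto simp: C_def disjointed_def)
    then show "\<omega> \<in> (\<Union>s. C s \<inter> E s)" by auto
  qed
  have int_C: "integrable M (\<lambda>\<omega>. indicator (C s) \<omega> * g \<omega>)" for s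
    using integrable_mult_indicator[OF C' g(1)] by simp
  have C_le: "prob (C s \<inter> E s) \<le> (\<integral>\<omega>. indicator (C s) \<omega> * g \<omega> \<partial>M)" for s
  proof -
    interpret finite_measure_subalgebra M "F s"
      by unfold_locales (rule sub)
    let ?Y = "real_cond_exp M (F s) (indicator (E s))"
    note int = integrable_indicator_mult[OF C' E(1), of s s]
    note meas = borel_measurable_indicator[OF C] borel_measurable_indicator[OF E(1)]
    have "prob (C s \<inter> E s) = (\<integral>\<omega>. indicator (C s) \<omega> * indicator (E s) \<omega> \<partial>M)"
      by (rule integral_indicator_mult[OF C' E(1), symmetric])
    also have "\<dots> = (\<integral>\<omega>. indicator (C s) \<omega> * ?Y \<omega> \<partial>M)"
      by (rule real_cond_exp_intg(2)[OF int meas, symmetric])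
    also have "\<dots> \<le> (\<integral>\<omega>. indicator (C s) \<omega> * g \<omega> \<partial>M)"
    proof (intro integral_mono_AE int_C)
      show "integrable M (\<lambda>\<omega>. indicator (C s) \<omega> * ?Y \<omega>)"
        by (rule real_cond_exp_intg(1)[OF int meas])
      show "AE \<omega> in M. indicator (C s) \<omega> * ?Y \<omega> \<le> indicator (C s) \<omega> * g \<omega>"
        using le[of s] by eventually_elim (auto simp: C_def disjointed_def indicator_def)
    qed
    finally show ?thesis .
  qed
  have "(\<lambda>s. prob (C s \<inter> E s)) sums prob (\<Union>s. C s \<inter> E s)"
    using disj by (intro finite_measure_UNION) (auto simp: disjoint_family_on_def)
  \<comment> \<open>By disjointness the indicators of the \<open>C s\<close> sum to at most 1; as
    \<open>g\<close> is nonnegative, one integral of \<open>g\<close> bounds all partial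
    sums.\<close>
  moreover have "(\<Sum>s<n. prob (C s \<inter> E s)) \<le> (\<integral>\<omega>. g \<omega> \<partial>M)" for n
  proof -
    have "(\<Sum>s<n. prob (C s \<inter> E s)) \<le> (\<Sum>s<n. \<integral>\<omega>. indicator (C s) \<omega> * g \<omega> \<partial>M)"
      by (intro sum_mono C_le)
    also have "\<dots> = (\<integral>\<omega>. indicator (\<Union>s<n. C s) \<omega> * g \<omega> \<partial>M)"
    proof -
      have "indicator (\<Union>s<n. C s) \<omega> = (\<Sum>s<n. indicator (C s) \<omega> :: real)" for \<omega>
        using disj by (intro indicator_UN_disjoint) (auto simp: disjoint_family_on_def)
      then show ?thesis
        by (simp only: sum_distrib_right Bochner_Integration.integral_sum[OF int_C])
    qed
    also have "\<dots> \<le> (\<integral>\<omega>. g \<omega> \<partial>M)"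
    proof (intro integral_mono_AE g(1))
      show "integrable M (\<lambda>\<omega>. indicator (\<Union>s<n. C s) \<omega> * g \<omega>)"
        using integrable_mult_indicator[OF _ g(1), of "\<Union>s<n. C s"] by simp
      show "AE \<omega> in M. indicator (\<Union>s<n. C s) \<omega> * g \<omega> \<le> g \<omega>"
        using g(2) by eventually_elim (simp add: indicator_def)
    qed
    finally show ?thesis .
  qed
  ultimately have "prob (\<Union>s. C s \<inter> E s) \<le> (\<integral>\<omega>. g \<omega> \<partial>M)"
    by (metis sums_iff suminf_le_const)
  moreover have "prob (\<Union>s. p s \<inter> E s) \<le> prob (\<Union>s. C s \<inter> E s)"
    using sub_CE by (intro finite_measure_mono) auto
  ultimately show ?thesis by linarith
qed

section \<open>Measurability and almost sure bounds for the normalized supermartingale\<close>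

locale normalized_supermartingale = prob_space P for P :: "'a measure" +
  fixes F :: "nat \<Rightarrow> 'a measure" and M :: "nat \<Rightarrow> 'a \<Rightarrow> real"
  assumes filt: "filtration (space P) F"
    and sub: "\<And>t. subalgebra P (F t)"
    and super: "supermartingale P F M"
    and nonneg: "\<And>t. AE \<omega> in P. 0 \<le> M t \<omega>"
    and start: "AE \<omega> in P. M 0 \<omega> = 1"
begin

lemma space_F: "space (F t) = space P"
  using sub[of t] by (simp add: subalgebra_def)

lemma sets_F: "A \<in> sets (F t) \<Longrightarrow> A \<in> events"
  using sub[of t] by (auto simp: subalgebra_def)

lemma measurable_F_mono: "f \<in> borel_measurable (F s) \<Longrightarrow> s \<le> t \<Longrightarrow> f \<in> borel_measurable (F t)"
  using filtration.sets_F_mono[OF filt, of s t] by (auto simp: measurable_def space_F)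

lemma measurable_M: "s \<le> t \<Longrightarrow> M s \<in> borel_measurable (F t)"
  using super measurable_F_mono by (auto simp: supermartingale_def)

lemma measurable_M_P[measurable]: "M s \<in> borel_measurable P"
  using measurable_from_subalg[OF sub measurable_M] by blast

lemma integrable_M: "integrable P (M t)"
  using super by (simp add: supermartingale_def)

lemma measurable_running_max: "s \<le> t \<Longrightarrow> running_max M s \<in> borel_measurable (F t)"
  unfolding running_max_def[abs_def] by (intro borel_measurable_Max measurable_M) auto

lemma measurable_running_max_P[measurable]: "running_max M s \<in> borel_measurable P"
  using measurable_from_subalg[OF sub measurable_running_max] by blast

lemma measurable_R: "R M t \<in> borel_measurable (F t)"
  unfolding R_def[abs_def]
  by (intro borel_measurable_Min borel_measurable_divide measurable_M measurable_running_max) auto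

lemma measurable_R_P[measurable]: "R M t \<in> borel_measurable P"
  by (rule measurable_from_subalg[OF sub measurable_R])

lemma measurable_tau_F_ge[measurable]: "Measurable.pred P (\<lambda>\<omega>. enat t \<le> tau_F M \<omega>)"
  unfolding le_tau_F_iff by measurable

lemma AE_nonneg: "AE \<omega> in P. \<forall>t. 0 \<le> M t \<omega>"
  using nonneg by (simp add: AE_all_countable)

lemma AE_running_max_ge_1: "AE \<omega> in P. \<forall>t. 1 \<le> running_max M t \<omega>"
  using start
proof eventually_elim
  case (elim \<omega>)
  then show ?case using running_max_ge[of 0 _ M \<omega>] by simp
qed

lemma AE_R_bounds: "AE \<omega> in P. \<forall>t. 0 \<le> R M t \<omega> \<and> R M t \<omega> \<le> 1"
  using AE_nonneg AE_running_max_ge_1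
proof eventually_elim
  case (elim \<omega>)
  show ?case
  proof
    fix t
    have "0 \<le> M s \<omega> / running_max M s \<omega>" for s
      using elim order_trans[OF zero_le_one] by (intro divide_nonneg_nonneg) auto
    moreover have "M 0 \<omega> / running_max M 0 \<omega> \<le> 1"
      by (simp add: running_max_0)
    ultimately show "0 \<le> R M t \<omega> \<and> R M t \<omega> \<le> 1"
      using R_le_ratio[of 0 t M \<omega>] by (auto simp: le_R_iff)
  qed
qed

section \<open>Ville's maximal inequality with a random level\<close>

text \<open>Dividing by a level that is at least 1 everywhere does not enlarge the absolute value,
  so \<open>M t\<close> itself is the integrable bound.\<close>

lemma integrable_div:
  assumes "b \<in> borel_measurable P" "\<And>\<omega>. 1 \<le> b \<omega>"
  shows "integrable P (\<lambda>\<omega>. M t \<omega> / b \<omega>)"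
proof (rule Bochner_Integration.integrable_bound[OF integrable_M[of t]])
  show "AE \<omega> in P. norm (M t \<omega> / b \<omega>) \<le> norm (M t \<omega>)"
  proof (rule AE_I2)
    fix \<omega>
    have "\<bar>M t \<omega>\<bar> / b \<omega> \<le> \<bar>M t \<omega>\<bar> / 1"
      using assms(2) by (intro divide_left_mono) (auto intro: less_le_trans[OF zero_less_one])
    then show "norm (M t \<omega> / b \<omega>) \<le> norm (M t \<omega>)"
      using assms(2)[of \<omega>] by simp
  qed
qed (use assms in measurable)

text \<open>The supermartingale inequality is integrated against the weight
  \<open>indicator A \<omega> / b \<omega>\<close>, which is nonnegative and
  \<open>F t\<close>-measurable and can therefore be moved through the conditional
  expectation.\<close>

lemma integral_Suc_le:
  assumes A: "A \<in> sets (F t)" and b: "b \<in> borel_measurable (F t)" "\<And>\<omega>. 1 \<le> b \<omega>"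
  shows "(\<integral>\<omega>. indicator A \<omega> * (M (Suc t) \<omega> / b \<omega>) \<partial>P) \<le> (\<integral>\<omega>. indicator A \<omega> * (M t \<omega> / b \<omega>) \<partial>P)"
proof -
  interpret finite_measure_subalgebra P "F t"
    by unfold_locales (rule sub)
  have bP: "b \<in> borel_measurable P"
    by (rule measurable_from_subalg[OF sub b(1)])
  note A[measurable] b(1)[measurable]
  have int: "integrable P (\<lambda>\<omega>. (indicator A \<omega> / b \<omega>) * M s \<omega>)" for s
    using integrable_mult_indicator[OF sets_F[OF A] integrable_div[OF bP b(2), where t = s]]
    by (simp add: field_simps)
  have meas: "(\<lambda>\<omega>. indicator A \<omega> / b \<omega> :: real) \<in> borel_measurable (F t)"
    by measurable
  let ?Y = "real_cond_exp P (F t) (M (Suc t))"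
  have "(\<integral>\<omega>. (indicator A \<omega> / b \<omega>) * M (Suc t) \<omega> \<partial>P) = (\<integral>\<omega>. (indicator A \<omega> / b \<omega>) * ?Y \<omega> \<partial>P)"
    by (intro real_cond_exp_intg(2)[symmetric] int meas measurable_M_P)
  also have "\<dots> \<le> (\<integral>\<omega>. (indicator A \<omega> / b \<omega>) * M t \<omega> \<partial>P)"
  proof (intro integral_mono_AE int real_cond_exp_intg(1) meas measurable_M_P)
    have "AE \<omega> in P. ?Y \<omega> \<le> M t \<omega>"
      using super by (simp add: supermartingale_def)
    then show "AE \<omega> in P. (indicator A \<omega> / b \<omega>) * ?Y \<omega> \<le> (indicator A \<omega> / b \<omega>) * M t \<omega>"
      by eventually_elim
        (intro mult_left_mono divide_nonneg_nonneg order_trans[OF zero_le_one b(2)] indicator_pos_le)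
  qed
  finally show ?thesis by (simp add: field_simps)
qed

text \<open>Induction on the horizon with \<open>t\<close> and \<open>A\<close> free and the level
  fixed. The part of \<open>A\<close> where \<open>M t\<close> has reached the level is handled by
  Markov's inequality. The rest still lies in \<open>F (Suc t)\<close>, so the induction hypothesis
  applies there, and \<open>integral_Suc_le\<close> carries its bound back to time
  \<open>t\<close>.\<close>

lemma ville_finite:
  assumes "A \<in> sets (F t)" "b \<in> borel_measurable (F t)" and b1: "\<And>\<omega>. 1 \<le> b \<omega>"
  shows "prob (A \<inter> {\<omega> \<in> space P. \<exists>s\<in>{t..t+n}. b \<omega> \<le> M s \<omega>})
      \<le> (\<integral>\<omega>. indicator A \<omega> * (M t \<omega> / b \<omega>) \<partial>P)"
  using assms(1,2)
proof (induction n arbitrary: t A)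
  have int: "integrable P (\<lambda>\<omega>. indicator A \<omega> * (M s \<omega> / b \<omega>))"
    if "A \<in> sets (F t)" "b \<in> borel_measurable (F t)" for A s t
    using integrable_mult_indicator[OF sets_F[OF that(1)] integrable_div[OF _ b1, where t = s]]
      measurable_from_subalg[OF sub that(2)] by simp
  \<comment> \<open>Markov's inequality: the quotient is at least 1 on this event. The integral
    stays restricted to the event, so that in the successor case the integral over the remaining
    part of \<open>A\<close> can be added to it.\<close>
  have first: "prob (A \<inter> {\<omega> \<in> space P. b \<omega> \<le> M t \<omega>})
      \<le> (\<integral>\<omega>. indicator (A \<inter> {\<omega> \<in> space P. b \<omega> \<le> M t \<omega>}) \<omega> * (M t \<omega> / b \<omega>) \<partial>P)"
    if A: "A \<in> sets (F t)" and b: "b \<in> borel_measurable (F t)" for A t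
  proof -
    note b[measurable] measurable_M[OF order_refl, measurable]
    let ?A = "A \<inter> {\<omega> \<in> space P. b \<omega> \<le> M t \<omega>}"
    have A': "?A \<in> sets (F t)"
      unfolding space_F[of t, symmetric] using A by measurable
    have "prob ?A = (\<integral>\<omega>. indicator ?A \<omega> \<partial>P)"
      using sets_F[OF A'] by simp
    also have "\<dots> \<le> (\<integral>\<omega>. indicator ?A \<omega> * (M t \<omega> / b \<omega>) \<partial>P)"
    proof (intro integral_mono int[OF A' b])
      show "integrable P (indicator ?A :: 'a \<Rightarrow> real)"
        by (rule integrable_indicator_event[OF sets_F[OF A']])
      show "indicator ?A \<omega> \<le> indicator ?A \<omega> * (M t \<omega> / b \<omega>)" for \<omega>
        using b1[of \<omega>] by (auto simp: indicator_def le_divide_eq)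
    qed
    finally show ?thesis .
  qed
  {
    case 0
    let ?A = "A \<inter> {\<omega> \<in> space P. b \<omega> \<le> M t \<omega>}"
    note 0(2)[measurable] measurable_M[OF order_refl, measurable]
    have A': "?A \<in> sets (F t)"
      unfolding space_F[of t, symmetric] using 0(1) by measurable
    have "(\<integral>\<omega>. indicator ?A \<omega> * (M t \<omega> / b \<omega>) \<partial>P) \<le> (\<integral>\<omega>. indicator A \<omega> * (M t \<omega> / b \<omega>) \<partial>P)"
    proof (intro integral_mono_AE int[OF A' 0(2)] int[OF 0(1,2)])
      show "AE \<omega> in P. indicator ?A \<omega> * (M t \<omega> / b \<omega>) \<le> indicator A \<omega> * (M t \<omega> / b \<omega>)"
        using nonneg[of t]
        by eventually_elim
          (use b1 in \<open>auto simp: indicator_def intro!: divide_nonneg_nonneg intro: order_trans[OF zero_le_one]\<close>)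
    qed
    then show ?case
      using first[OF 0] by simp
  next
    case (Suc n)
    note Suc.prems(2)[measurable] measurable_M[OF order_refl, measurable]
    note A = Suc.prems(1)
    let ?A1 = "A \<inter> {\<omega> \<in> space P. b \<omega> \<le> M t \<omega>}" and ?A2 = "A - {\<omega> \<in> space P. b \<omega> \<le> M t \<omega>}"
    let ?H = "\<lambda>t n. {\<omega> \<in> space P. \<exists>s\<in>{t..t+n}. b \<omega> \<le> M s \<omega>}"
    have b: "b \<in> borel_measurable (F (Suc t))"
      using measurable_F_mono[OF Suc.prems(2)] by simp
    have [measurable]: "b \<in> borel_measurable P"
      by (rule measurable_from_subalg[OF sub b])
    have A1: "?A1 \<in> sets (F t)" and A2: "?A2 \<in> sets (F t)"
      unfolding space_F[of t, symmetric] using A by measurable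
    have A2': "?A2 \<in> sets (F (Suc t))"
      using A2 filtration.sets_F_mono[OF filt, of t "Suc t"] by auto
    have "prob (A \<inter> ?H t (Suc n)) \<le> prob (?A1 \<union> (?A2 \<inter> ?H (Suc t) n))"
    proof (intro finite_measure_mono)
      show "A \<inter> ?H t (Suc n) \<subseteq> ?A1 \<union> (?A2 \<inter> ?H (Suc t) n)"
      proof
        fix \<omega> assume "\<omega> \<in> A \<inter> ?H t (Suc n)"
        then obtain s where s: "\<omega> \<in> A" "\<omega> \<in> space P" "t \<le> s" "s \<le> t + Suc n" "b \<omega> \<le> M s \<omega>"
          by auto
        then show "\<omega> \<in> ?A1 \<union> (?A2 \<inter> ?H (Suc t) n)"
          by (cases "s = t") (auto intro!: bexI[of _ s])
      qed
    qed (use sets_F[OF A1] sets_F[OF A2] in measurable)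
    also have "\<dots> \<le> prob ?A1 + prob (?A2 \<inter> ?H (Suc t) n)"
      by (intro measure_Un_le) (use sets_F[OF A1] sets_F[OF A2] in measurable)
    also have "\<dots> \<le> (\<integral>\<omega>. indicator ?A1 \<omega> * (M t \<omega> / b \<omega>) \<partial>P)
        + (\<integral>\<omega>. indicator ?A2 \<omega> * (M (Suc t) \<omega> / b \<omega>) \<partial>P)"
      by (intro add_mono first[OF Suc.prems] Suc.IH[OF A2' b])
    also have "\<dots> \<le> (\<integral>\<omega>. indicator ?A1 \<omega> * (M t \<omega> / b \<omega>) \<partial>P)
        + (\<integral>\<omega>. indicator ?A2 \<omega> * (M t \<omega> / b \<omega>) \<partial>P)"
      by (intro add_left_mono integral_Suc_le[OF A2 Suc.prems(2) b1])
    also have "\<dots> = (\<integral>\<omega>. indicator ?A1 \<omega> * (M t \<omega> / b \<omega>) + indicator ?A2 \<omega> * (M t \<omega> / b \<omega>) \<partial>P)"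
      by (rule Bochner_Integration.integral_add[symmetric])
        (rule int[OF A1 Suc.prems(2)] int[OF A2 Suc.prems(2)])+
    also have "\<dots> = (\<integral>\<omega>. indicator A \<omega> * (M t \<omega> / b \<omega>) \<partial>P)"
      by (intro Bochner_Integration.integral_cong) (auto simp: indicator_def)
    finally show ?case .
  }
qed

text \<open>The bound of \<open>ville_finite\<close> does not depend on \<open>n\<close>, and the
  events increase with \<open>n\<close> to the event with an unbounded horizon.\<close>

lemma ville:
  assumes A: "A \<in> sets (F t)" and b: "b \<in> borel_measurable (F t)" "\<And>\<omega>. 1 \<le> b \<omega>"
  shows "prob (A \<inter> {\<omega> \<in> space P. \<exists>s\<ge>t. b \<omega> \<le> M s \<omega>})
      \<le> (\<integral>\<omega>. indicator A \<omega> * (M t \<omega> / b \<omega>) \<partial>P)"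
proof -
  let ?H = "\<lambda>n. A \<inter> {\<omega> \<in> space P. \<exists>s\<in>{t..t+n}. b \<omega> \<le> M s \<omega>}"
  note sets_F[OF A, measurable] measurable_from_subalg[OF sub b(1), measurable]
  have "(\<lambda>n. prob (?H n)) \<longlonglongrightarrow> prob (\<Union>n. ?H n)"
    by (intro finite_Lim_measure_incseq) (auto simp: incseq_def)
  moreover have "(\<Union>n. ?H n) = A \<inter> {\<omega> \<in> space P. \<exists>s\<ge>t. b \<omega> \<le> M s \<omega>}"
  proof (intro set_eqI iffI)
    fix \<omega> assume "\<omega> \<in> A \<inter> {\<omega> \<in> space P. \<exists>s\<ge>t. b \<omega> \<le> M s \<omega>}"
    then obtain s where "\<omega> \<in> A" "\<omega> \<in> space P" "t \<le> s" "b \<omega> \<le> M s \<omega>" by auto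
    then have "\<omega> \<in> ?H (s - t)" by auto
    then show "\<omega> \<in> (\<Union>n. ?H n)" by blast
  qed auto
  ultimately show ?thesis
    using ville_finite[OF A b] by (intro LIMSEQ_le_const2) auto
qed

section \<open>Comparison of \<open>Z\<close> with the ratio of \<open>M\<close> to its running
  maximum\<close>

text \<open>If \<open>t\<close> is at most \<open>tau_F\<close>, some \<open>s \<ge> t\<close> has
  \<open>M s \<omega>\<close> equal to its running maximum, which is at least the one at
  \<open>t\<close>. So the level \<open>running_max M t \<omega>\<close> is reached at or after
  \<open>t\<close>, and \<open>ville\<close> bounds this on every test set in
  \<open>F t\<close>.\<close>

lemma Z_le: "AE \<omega> in P. Z P F M t \<omega> \<le> M t \<omega> / running_max M t \<omega>"
proof -
  \<comment> \<open>The running maximum is at least 1 only almost surely, while \<open>ville\<close>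
    asks for a level that is at least 1 everywhere. The truncation changes it on a null set
    only.\<close>
  define b where "b = (\<lambda>\<omega>. max 1 (running_max M t \<omega>))"
  note measurable_running_max[OF order_refl, measurable] measurable_M[OF order_refl, measurable]
  have b: "b \<in> borel_measurable (F t)" "\<And>\<omega>. 1 \<le> b \<omega>"
    unfolding b_def by (intro borel_measurable_max borel_measurable_const measurable_running_max order_refl)
      simp
  note b(1)[measurable]
  have bP[measurable]: "b \<in> borel_measurable P"
    by (rule measurable_from_subalg[OF sub b(1)])
  have "AE \<omega> in P. real_cond_exp P (F t) (indicator {\<omega> \<in> space P. enat t \<le> tau_F M \<omega>}) \<omega>
      \<le> M t \<omega> / b \<omega>"
  proof (rule cond_prob_le[OF sub])
    show "integrable P (\<lambda>\<omega>. M t \<omega> / b \<omega>)"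
      by (rule integrable_div[OF bP b(2)])
    fix A assume A: "A \<in> sets (F t)"
    have "prob (A \<inter> {\<omega> \<in> space P. enat t \<le> tau_F M \<omega>})
        \<le> prob (A \<inter> {\<omega> \<in> space P. \<exists>s\<ge>t. b \<omega> \<le> M s \<omega>})"
    proof (rule finite_measure_mono_AE)
      show "AE \<omega> in P. \<omega> \<in> A \<inter> {\<omega> \<in> space P. enat t \<le> tau_F M \<omega>} \<longrightarrow>
          \<omega> \<in> A \<inter> {\<omega> \<in> space P. \<exists>s\<ge>t. b \<omega> \<le> M s \<omega>}"
        using AE_running_max_ge_1
      proof eventually_elim
        case (elim \<omega>)
        then show ?case
          using running_max_mono[of t _ M \<omega>] by (fastforce simp: le_tau_F_iff b_def)
      qed
    qed (use sets_F[OF A] in measurable)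
    also have "\<dots> \<le> (\<integral>\<omega>. indicator A \<omega> * (M t \<omega> / b \<omega>) \<partial>P)"
      by (rule ville[OF A b])
    finally show "prob (A \<inter> {\<omega> \<in> space P. enat t \<le> tau_F M \<omega>})
        \<le> (\<integral>\<omega>. indicator A \<omega> * (M t \<omega> / b \<omega>) \<partial>P)" .
  qed measurable
  with AE_running_max_ge_1 show ?thesis
    by eventually_elim (simp add: Z_def prob_given_def b_def max_def split: if_splits)
qed

lemma measurable_Z: "Z P F M t \<in> borel_measurable (F t)"
  by (simp add: Z_def prob_given_def)

lemma measurable_Z_P[measurable]: "Z P F M t \<in> borel_measurable P"
  by (rule measurable_from_subalg[OF sub measurable_Z])

section \<open>Hitting events that occur no later than \<open>tau_F\<close>\<close>

text \<open>\<open>prob_hitting_le\<close> is applied to the events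
  \<open>enat s \<le> tau_F M \<omega>\<close>, which decrease in \<open>s\<close> and whose
  conditional probabilities given \<open>F s\<close> are \<open>Z P F M s\<close>.\<close>

lemma prob_hitting_before_tau_F_le:
  assumes "\<And>s. p s \<in> sets (F s)" "integrable P g" "AE \<omega> in P. 0 \<le> g \<omega>"
    and "\<And>s. AE \<omega> in P. \<omega> \<in> p s \<longrightarrow> Z P F M s \<omega> \<le> g \<omega>"
  shows "prob (\<Union>s. p s \<inter> {\<omega> \<in> space P. enat s \<le> tau_F M \<omega>}) \<le> (\<integral>\<omega>. g \<omega> \<partial>P)"
  using assms by (intro prob_hitting_le[OF filt sub])
    (auto simp: Z_def prob_given_def intro: order_trans[rotated])

text \<open>By \<open>Z_le\<close>, the constant \<open>c\<close> bounds \<open>Z\<close> wherever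
  the ratio is below \<open>c\<close>. The event covers all times up to \<open>tau_F\<close> at
  once, so a single estimate serves every stopping time bounded by \<open>tau_F\<close>.\<close>

lemma prob_ratio_less_before_tau_F:
  assumes "0 \<le> c"
  shows "prob {\<omega> \<in> space P. \<exists>s. M s \<omega> / running_max M s \<omega> < c \<and> enat s \<le> tau_F M \<omega>} \<le> c"
proof -
  let ?p = "\<lambda>s. {\<omega> \<in> space P. M s \<omega> / running_max M s \<omega> < c}"
  have "prob (\<Union>s. ?p s \<inter> {\<omega> \<in> space P. enat s \<le> tau_F M \<omega>}) \<le> (\<integral>\<omega>. c \<partial>P)"
  proof (rule prob_hitting_before_tau_F_le)
    fix s
    note measurable_running_max[OF order_refl, measurable] measurable_M[OF order_refl, measurable]
    show "?p s \<in> sets (F s)"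
      unfolding space_F[of s, symmetric] by measurable
    show "AE \<omega> in P. \<omega> \<in> ?p s \<longrightarrow> Z P F M s \<omega> \<le> c"
      using Z_le[of s] by eventually_elim auto
  qed (use assms in auto)
  also have "(\<Union>s. ?p s \<inter> {\<omega> \<in> space P. enat s \<le> tau_F M \<omega>})
      = {\<omega> \<in> space P. \<exists>s. M s \<omega> / running_max M s \<omega> < c \<and> enat s \<le> tau_F M \<omega>}"
    by auto
  finally show ?thesis
    by (simp add: prob_space)
qed

section \<open>The tail of \<open>R\<close> at a stopping time bounded by
  \<open>tau_F\<close>\<close>

text \<open>An extended time is determined by the finite \<open>t\<close> that bound it, \<infinity>
  being the value that none of them bounds. Each fibre is thus a countable intersection of
  events.\<close>

lemma measurable_enat_stopping_time:
  assumes "enat_stopping_time F \<tau>"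
  shows "\<tau> \<in> measurable P (count_space UNIV)"
proof (simp add: measurable_count_space_eq2_countable, rule allI)
  fix a
  have [measurable]: "Measurable.pred P (\<lambda>\<omega>. \<tau> \<omega> \<le> enat t)" for t
    using assms sub[of t] by (auto simp: enat_stopping_time_def intro: measurable_from_subalg)
  have "x = y \<longleftrightarrow> (\<forall>t. x \<le> enat t \<longleftrightarrow> y \<le> enat t)" for x y
    by (cases x; cases y) (auto intro: antisym)
  then have "\<tau> -` {a} \<inter> space P = {\<omega> \<in> space P. \<forall>t. \<tau> \<omega> \<le> enat t \<longleftrightarrow> a \<le> enat t}"
    by auto
  also have "\<dots> \<in> events" by measurable
  finally show "\<tau> -` {a} \<inter> space P \<in> events" .
qed

lemma measurable_R_at:
  assumes "enat_stopping_time F \<tau>"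
  shows "R_at M \<tau> \<in> borel_measurable P"
proof -
  note measurable_enat_stopping_time[OF assms, measurable]
  have "(\<lambda>\<omega>. case \<tau> \<omega> of enat t \<Rightarrow> R M t \<omega> | \<infinity> \<Rightarrow> (INF t. R M t \<omega>)) \<in> borel_measurable P"
    by measurable
  then show ?thesis
    by (simp add: R_at_def[abs_def])
qed

text \<open>If \<open>R_at M \<tau> \<omega>\<close> is below \<open>c\<close>, some ratio at a
  finite time \<open>s \<le> \<tau> \<omega>\<close> is below \<open>c\<close>, and almost surely
  this \<open>s\<close> is at most \<open>tau_F\<close>. The complementary event is then bounded by
  \<open>prob_ratio_less_before_tau_F\<close>.\<close>

lemma prob_R_at_ge:
  assumes st: "enat_stopping_time F \<tau>" and le: "AE \<omega> in P. \<tau> \<omega> \<le> tau_F M \<omega>" and "0 \<le> c"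
  shows "1 - c \<le> prob {\<omega> \<in> space P. c \<le> R_at M \<tau> \<omega>}"
proof -
  note measurable_R_at[OF st, measurable]
  let ?B = "{\<omega> \<in> space P. \<exists>s. M s \<omega> / running_max M s \<omega> < c \<and> enat s \<le> tau_F M \<omega>}"
  have "prob {\<omega> \<in> space P. \<not> c \<le> R_at M \<tau> \<omega>} \<le> prob ?B"
  proof (rule finite_measure_mono_AE)
    show "AE \<omega> in P. \<omega> \<in> {\<omega> \<in> space P. \<not> c \<le> R_at M \<tau> \<omega>} \<longrightarrow> \<omega> \<in> ?B"
      using le
    proof eventually_elim
      case (elim \<omega>)
      show ?case
      proof
        assume *: "\<omega> \<in> {\<omega> \<in> space P. \<not> c \<le> R_at M \<tau> \<omega>}"
        obtain t where t: "R M t \<omega> < c" "enat t \<le> \<tau> \<omega>"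
        proof (cases "\<tau> \<omega>")
          case (enat t)
          then show ?thesis
            using * that[of t] by (simp add: R_at_def)
        next
          case infinity
          \<comment> \<open>An infimum below \<open>c\<close> is undercut at some finite time, so
            the infinite case reduces to the finite one.\<close>
          have "\<exists>t. R M t \<omega> < c"
          proof (rule ccontr)
            assume "\<nexists>t. R M t \<omega> < c"
            then have "c \<le> (INF t. R M t \<omega>)"
              by (intro cINF_greatest) (auto simp: not_less)
            then show False
              using * infinity by (simp add: R_at_def)
          qed
          then show ?thesis
            using that infinity by auto
        qed
        then obtain s where s: "s \<le> t" "M s \<omega> / running_max M s \<omega> < c"
          by (auto simp: R_less_iff)
        then have "enat s \<le> tau_F M \<omega>"
          using t(2) elim by (meson enat_ord_simps(1) order_trans)
        with s * show "\<omega> \<in> ?B" by auto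
      qed
    qed
  qed measurable
  also have "\<dots> \<le> c"
    by (rule prob_ratio_less_before_tau_F[OF \<open>0 \<le> c\<close>])
  finally show ?thesis
    using prob_neg[of "\<lambda>\<omega>. c \<le> R_at M \<tau> \<omega>"] by simp
qed

section \<open>The last minimum of \<open>Z\<close> up to \<open>tau_F\<close>\<close>

text \<open>This form has only countable quantifiers, which gives measurability of the event. If
  \<open>Z\<close> attains no minimum up to \<open>tau_F\<close>, both sides are false, the left one
  because the last time of the empty set is 0.\<close>

lemma less_rho_F_iff:
  "enat t < rho_F P F M \<omega> \<longleftrightarrow>
    (\<exists>s>t. enat s \<le> tau_F M \<omega> \<and> (\<forall>u. enat u \<le> tau_F M \<omega> \<longrightarrow> Z P F M s \<omega> \<le> Z P F M u \<omega>))"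
  by (auto simp: rho_F_def enat_less_last_time_iff is_arg_min_linorder)

text \<open>On a test set \<open>A\<close> in \<open>F t\<close>, a minimizer of \<open>Z\<close>
  later than \<open>t\<close> is a time after \<open>t\<close>, no later than \<open>tau_F\<close>,
  at which \<open>Z\<close> is at most \<open>R M t \<omega>\<close>. The hitting estimate with
  \<open>g\<close> equal to \<open>R M t\<close> restricted to \<open>A\<close> bounds the
  probability of such a time.\<close>

lemma rho_F_prob_le_R:
  "AE \<omega> in P. prob_given P (F t) (\<lambda>\<omega>. enat t < rho_F P F M \<omega>) \<omega> \<le> R M t \<omega>"
  unfolding prob_given_def
proof (rule cond_prob_le[OF sub _ measurable_R])
  let ?B = "{\<omega> \<in> space P. enat t < rho_F P F M \<omega>}"
  have int_R: "integrable P (R M t)"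
    using AE_R_bounds by (intro integrable_const_bound[of _ 1]) (auto elim: eventually_mono)
  show "integrable P (R M t)" by (fact int_R)
  show B[measurable]: "?B \<in> events"
    unfolding less_rho_F_iff by measurable
  fix A assume A: "A \<in> sets (F t)"
  \<comment> \<open>Only times after \<open>t\<close> count: for these, \<open>A\<close> and
    \<open>R M t\<close> are known at time \<open>s\<close>, so that \<open>p s\<close> lies in
    \<open>F s\<close>.\<close>
  define p where "p = (\<lambda>s. if t < s then A \<inter> {\<omega> \<in> space P. Z P F M s \<omega> \<le> R M t \<omega>} else {})"
  have p: "p s \<in> sets (F s)" for s
  proof (cases "t < s")
    case True
    have A': "A \<in> sets (F s)"
      using A True filtration.sets_F_mono[OF filt, of t s] by auto
    note measurable_Z[measurable]
    have [measurable]: "R M t \<in> borel_measurable (F s)"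
      using True by (intro measurable_F_mono[OF measurable_R]) simp
    have "{\<omega> \<in> space P. Z P F M s \<omega> \<le> R M t \<omega>} \<in> sets (F s)"
      unfolding space_F[of s, symmetric] by measurable
    then show ?thesis
      using A' True by (auto simp: p_def)
  qed (simp add: p_def)
  have "prob (A \<inter> ?B) \<le> prob (\<Union>s. p s \<inter> {\<omega> \<in> space P. enat s \<le> tau_F M \<omega>})"
  proof (rule finite_measure_mono_AE)
    have "AE \<omega> in P. \<forall>u. Z P F M u \<omega> \<le> M u \<omega> / running_max M u \<omega>"
      using Z_le by (simp add: AE_all_countable)
    then show "AE \<omega> in P. \<omega> \<in> A \<inter> ?B \<longrightarrow> \<omega> \<in> (\<Union>s. p s \<inter> {\<omega> \<in> space P. enat s \<le> tau_F M \<omega>})"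
    proof eventually_elim
      case (elim \<omega>)
      show ?case
      proof
        assume *: "\<omega> \<in> A \<inter> ?B"
        then obtain s where s: "t < s" "enat s \<le> tau_F M \<omega>"
          "\<And>u. enat u \<le> tau_F M \<omega> \<Longrightarrow> Z P F M s \<omega> \<le> Z P F M u \<omega>"
          by (auto simp: less_rho_F_iff)
        \<comment> \<open>Every \<open>u \<le> t\<close> precedes \<open>s\<close> and hence is no
          later than \<open>tau_F\<close>, so it competes in the minimum that \<open>s\<close>
          attains; \<open>Z_le\<close> at \<open>u\<close> then gives the ratio.\<close>
        have "Z P F M s \<omega> \<le> M u \<omega> / running_max M u \<omega>" if "u \<le> t" for u
        proof -
          have "enat u \<le> tau_F M \<omega>"
            using that s(1,2) by (meson enat_ord_simps(1) le_less_trans less_imp_le order_trans)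
          then show ?thesis
            using s(3) elim order_trans by blast
        qed
        then have "Z P F M s \<omega> \<le> R M t \<omega>"
          by (simp add: le_R_iff)
        then show "\<omega> \<in> (\<Union>s. p s \<inter> {\<omega> \<in> space P. enat s \<le> tau_F M \<omega>})"
          using * s by (auto simp: p_def)
      qed
    qed
  qed (use sets_F[OF p] in measurable)
  also have "\<dots> \<le> (\<integral>\<omega>. indicator A \<omega> * R M t \<omega> \<partial>P)"
  proof (rule prob_hitting_before_tau_F_le[OF p])
    show "integrable P (\<lambda>\<omega>. indicator A \<omega> * R M t \<omega>)"
      using integrable_mult_indicator[OF sets_F[OF A] int_R] by simp
    show "AE \<omega> in P. 0 \<le> indicator A \<omega> * R M t \<omega>"
      using AE_R_bounds by eventually_elim (simp add: indicator_def)
    show "AE \<omega> in P. \<omega> \<in> p s \<longrightarrow> Z P F M s \<omega> \<le> indicator A \<omega> * R M t \<omega>" for s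
      by (auto simp: p_def indicator_def)
  qed
  finally show "prob (A \<inter> ?B) \<le> (\<integral>\<omega>. indicator A \<omega> * R M t \<omega> \<partial>P)" .
qed

end

section \<open>Comparison with the uniform tail at every threshold, and the conclusion\<close>

theorem theorem3:
  fixes P :: "'a measure" and F :: "nat \<Rightarrow> 'a measure" and M :: "nat \<Rightarrow> 'a \<Rightarrow> real"
    and Q :: "'b measure" and U :: "'b \<Rightarrow> real"
  assumes "prob_space P"
    and "filtration (space P) F"
    and "\<And>t. subalgebra P (F t)"
    and "supermartingale P F M"
    and "\<And>t. AE \<omega> in P. M t \<omega> \<ge> 0"
    and "AE \<omega> in P. M 0 \<omega> = 1"
    and "prob_space Q"
    and "distributed Q lborel U (\<lambda>x. indicator {0..1} x / measure lborel {0..1::real})"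
  shows "(\<forall>\<tau>. enat_stopping_time F \<tau> \<longrightarrow> (AE \<omega> in P. \<tau> \<omega> \<le> tau_F M \<omega>) \<longrightarrow>
            stoch_dominates P (R_at M \<tau>) Q U) \<and>
         (\<forall>t. AE \<omega> in P. R M t \<omega> \<ge> prob_given P (F t) (\<lambda>\<omega>. rho_F P F M \<omega> > enat t) \<omega>)"
proof -
  interpret normalized_supermartingale P F M
    using assms(1-6) by (simp add: normalized_supermartingale_def normalized_supermartingale_axioms_def)
  interpret Q: prob_space Q by (rule assms(7))
  have "measure Q {\<omega> \<in> space Q. c \<le> U \<omega>} \<le> prob {\<omega> \<in> space P. c \<le> R_at M \<tau> \<omega>}"
    if \<tau>: "enat_stopping_time F \<tau>" "AE \<omega> in P. \<tau> \<omega> \<le> tau_F M \<omega>" for \<tau> c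
  proof -
    \<comment> \<open>Both tail bounds equal \<open>1 - c\<close> for \<open>c\<close> between 0 and
      1. Below 0 and above 1, monotonicity in \<open>c\<close> reduces to the endpoints, where the
      tail of \<open>R_at M \<tau>\<close> is at least 1 and the tail of \<open>U\<close> is at most
      0, respectively.\<close>
    consider "c < 0" | "0 \<le> c" "c \<le> 1" | "1 < c" by linarith
    then show ?thesis
    proof cases
      case 1
      have "prob {\<omega> \<in> space P. 0 \<le> R_at M \<tau> \<omega>} \<le> prob {\<omega> \<in> space P. c \<le> R_at M \<tau> \<omega>}"
        using 1 measurable_R_at[OF \<tau>(1)] by (intro finite_measure_mono) auto
      then show ?thesis
        using prob_R_at_ge[OF \<tau>, of 0] Q.prob_le_1[of "{\<omega> \<in> space Q. c \<le> U \<omega>}"] by linarith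
    next
      case 2
      then show ?thesis
        using prob_R_at_ge[OF \<tau>, of c] Q.uniform_ge_le[OF assms(8), of c] by simp
    next
      case 3
      have [measurable]: "U \<in> borel_measurable Q"
        using distributed_measurable[OF assms(8)] by simp
      have "measure Q {\<omega> \<in> space Q. c \<le> U \<omega>} \<le> measure Q {\<omega> \<in> space Q. 1 \<le> U \<omega>}"
        using 3 by (intro Q.finite_measure_mono) auto
      then have "measure Q {\<omega> \<in> space Q. c \<le> U \<omega>} \<le> 0"
        using Q.uniform_ge_le[OF assms(8), of 1] by simp
      then show ?thesis
        using measure_nonneg order_trans by blast
    qed
  qed
  then show ?thesis
    using rho_F_prob_le_R by (auto simp: stoch_dominates_def)
qed

end
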